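(* Let $K$ be a field, $q\in K$ a primitive $n$'th root of unity with $n\ge2$, and $\mathbb{A}=K[h][x;\sigma]$ with $\sigma(h)=qh$. For $\lambda,\mu\in K^\times$ let $t_{\lambda,\mu}:h\mapsto\lambda h,\ x\mapsto\mu x$ and, if $n=2$, let $t'_{\lambda,\mu}:h\mapsto\lambda x,\ x\mapsto\mu h$. Let $\mathbb{T}^2=\{t_{\lambda,\mu}\mid\lambda,\mu\in K^\times\}$ and, if $n=2$, $\mathbb{I}=\{1,\iota\}$ where $\iota:h\mapsto x,\ x\mapsto h$. Then $$\mathrm{Aut}_K(\mathbb{A})=\begin{cases}\mathbb{T}^2\rtimes\mathbb{I}=\{t_{\lambda,\mu},t'_{\lambda,\mu}\mid\lambda,\mu\in K^\times\}&\text{if }n=2,\\ \mathbb{T}^2=\{t_{\lambda,\mu}\mid\lambda,\mu\in K^\times\}&\text{if }n\neq2,\end{cases}$$ where in the semidirect product $\mathbb{T}^2$ is the normal subgroup.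
   Context: $\mathbb{A}$ is the $K$-algebra generated by $h,x$ with the relation $xh=qhx$. $\mathrm{Aut}_K(\mathbb{A})$ is the group of $K$-algebra automorphisms of $\mathbb{A}$. Each map is specified by its values on the generators $h,x$. *)

theory Defs
  imports
    "HOL-Computational_Algebra.Polynomial"
    "HOL-Algebra.Module"
    "HOL-Algebra.Coset"
    "HOL-Algebra.Bij"
begin

hide_const (open) Polynomial.smult

definition primitive_root_of_unity :: "nat \<Rightarrow> 'a::monoid_mult \<Rightarrow> bool" where
  "primitive_root_of_unity n z \<longleftrightarrow>
     n > 0 \<and> z ^ n = 1 \<and> (\<forall>m. 0 < m \<and> m < n \<longrightarrow> z ^ m \<noteq> 1)"


subsection \<open>Skew polynomial rings\<close>

text \<open>
  The skew polynomial ring \<open>R[x;\<sigma>]\<close> has the underlying additive group of \<open>R[x]\<close>, with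
  coefficients written on the left of the powers of \<open>x\<close>, and the multiplication
  determined by \<open>x a = \<sigma>(a) x\<close>, so that \<open>a x\<^sup>i \<cdot> b x\<^sup>j = a \<sigma>\<^sup>i(b) x\<^sup>i\<^sup>+\<^sup>j\<close>.
\<close>

definition skew_mult :: "('a::comm_ring_1 \<Rightarrow> 'a) \<Rightarrow> 'a poly \<Rightarrow> 'a poly \<Rightarrow> 'a poly" where
  "skew_mult \<sigma> f g =
     (\<Sum>i\<le>degree f. \<Sum>j\<le>degree g. monom (coeff f i * (\<sigma> ^^ i) (coeff g j)) (i + j))"

text \<open>
  \<open>K[h]\<close> is \<open>'k poly\<close>, and \<open>K[h][x;\<sigma>]\<close> lives on \<open>'k poly poly\<close>: the inner variable is
  \<open>h\<close>, the outer one is \<open>x\<close>.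
\<close>

definition q_shift :: "'k::field \<Rightarrow> 'k poly \<Rightarrow> 'k poly" where
  "q_shift q p = pcompose p [:0, q:]"

definition quantum_plane :: "'k::field \<Rightarrow> ('k, 'k poly poly) module" where
  "quantum_plane q =
     \<lparr>carrier = UNIV, monoid.mult = skew_mult (q_shift q), one = 1, zero = 0, add = (+),
      smult = (\<lambda>c. Polynomial.smult [:c:])\<rparr>"

definition gen_h :: "'k::field poly poly" where
  "gen_h = [:[:0, 1:]:]"

definition gen_x :: "'k::field poly poly" where
  "gen_x = [:0, 1:]"


subsection \<open>Algebra endomorphisms and automorphisms\<close>

text \<open>
  The library locale for algebras is restricted to commutative ones, so only its record type
  is used here; the scalars are the whole type \<open>'k\<close>.  As for the library's
  \<^const>\<open>AutoGroup\<close>, maps are extensional on the carrier.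
\<close>

definition alg_End :: "('k, 'a) module \<Rightarrow> ('a \<Rightarrow> 'a) set" where
  "alg_End A = {f \<in> ring_hom A A \<inter> extensional (carrier A).
     \<forall>c. \<forall>a\<in>carrier A. f (c \<odot>\<^bsub>A\<^esub> a) = c \<odot>\<^bsub>A\<^esub> f a}"

definition alg_Aut :: "('k, 'a) module \<Rightarrow> ('a \<Rightarrow> 'a) monoid" where
  "alg_Aut A = BijGroup (carrier A) \<lparr>carrier := alg_End A \<inter> Bij (carrier A)\<rparr>"

definition end_of_gens ::
  "'k::field \<Rightarrow> 'k poly poly \<Rightarrow> 'k poly poly \<Rightarrow> 'k poly poly \<Rightarrow> 'k poly poly" where
  "end_of_gens q u v = (THE f. f \<in> alg_End (quantum_plane q) \<and> f gen_h = u \<and> f gen_x = v)"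

definition t_map :: "'k::field \<Rightarrow> 'k \<Rightarrow> 'k \<Rightarrow> 'k poly poly \<Rightarrow> 'k poly poly" where
  "t_map q l m = end_of_gens q (l \<odot>\<^bsub>quantum_plane q\<^esub> gen_h) (m \<odot>\<^bsub>quantum_plane q\<^esub> gen_x)"

definition t'_map :: "'k::field \<Rightarrow> 'k \<Rightarrow> 'k \<Rightarrow> 'k poly poly \<Rightarrow> 'k poly poly" where
  "t'_map q l m = end_of_gens q (l \<odot>\<^bsub>quantum_plane q\<^esub> gen_x) (m \<odot>\<^bsub>quantum_plane q\<^esub> gen_h)"

definition iota :: "'k::field \<Rightarrow> 'k poly poly \<Rightarrow> 'k poly poly" where
  "iota q = end_of_gens q gen_x gen_h"

definition torus :: "'k::field \<Rightarrow> ('k poly poly \<Rightarrow> 'k poly poly) set" where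
  "torus q = {t_map q l m | l m. l \<noteq> 0 \<and> m \<noteq> 0}"

definition swap_group :: "'k::field \<Rightarrow> ('k poly poly \<Rightarrow> 'k poly poly) set" where
  "swap_group q = {\<one>\<^bsub>alg_Aut (quantum_plane q)\<^esub>, iota q}"

text \<open>\<open>G = N \<rtimes> H\<close>\<close>

definition internal_semidirect :: "('a, 'b) monoid_scheme \<Rightarrow> 'a set \<Rightarrow> 'a set \<Rightarrow> bool" where
  "internal_semidirect G N H \<longleftrightarrow>
     N \<lhd> G \<and> subgroup H G \<and> N \<inter> H = {\<one>\<^bsub>G\<^esub>} \<and> N <#>\<^bsub>G\<^esub> H = carrier G"


subsection \<open>Sanity of the definitions\<close>

lemma skew_mult_bound:
  assumes "\<sigma> 0 = 0" "degree f \<le> M" "degree g \<le> N"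
  shows "skew_mult \<sigma> f g =
    (\<Sum>i\<le>M. \<Sum>j\<le>N. monom (coeff f i * (\<sigma> ^^ i) (coeff g j)) (i + j))"
proof -
  have z: "(\<sigma> ^^ i) 0 = 0" for i
    by (induction i) (simp_all add: assms(1))
  have "(\<Sum>i\<le>M. \<Sum>j\<le>N. monom (coeff f i * (\<sigma> ^^ i) (coeff g j)) (i + j))
      = (\<Sum>i\<le>M. \<Sum>j\<le>degree g. monom (coeff f i * (\<sigma> ^^ i) (coeff g j)) (i + j))"
    using assms(3)
    by (intro sum.cong sum.mono_neutral_right refl) (auto simp: coeff_eq_0 z)
  also have "\<dots> = skew_mult \<sigma> f g"
    unfolding skew_mult_def using assms(2)
    by (intro sum.mono_neutral_right) (auto simp: coeff_eq_0)
  finally show ?thesis by simp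
qed

lemma skew_mult_monom:
  assumes "\<sigma> 0 = 0"
  shows "skew_mult \<sigma> (monom a i) (monom b j) = monom (a * (\<sigma> ^^ i) b) (i + j)"
proof -
  have z: "(\<sigma> ^^ i) 0 = 0" for i
    by (induction i) (simp_all add: assms(1))
  have "skew_mult \<sigma> (monom a i) (monom b j) = (\<Sum>k\<le>i. \<Sum>l\<le>j.
      monom (coeff (monom a i) k * (\<sigma> ^^ k) (coeff (monom b j) l)) (k + l))"
    by (rule skew_mult_bound) (simp_all add: assms degree_monom_le)
  also have "\<dots> = (\<Sum>k\<le>i. \<Sum>l\<le>j. if k = i \<and> l = j then monom (a * (\<sigma> ^^ i) b) (i + j) else 0)"
    by (intro sum.cong refl) (auto simp: z)
  also have "\<dots> = (\<Sum>k\<le>i. if k = i then monom (a * (\<sigma> ^^ i) b) (i + j) else 0)"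
    by (intro sum.cong refl) auto
  also have "\<dots> = monom (a * (\<sigma> ^^ i) b) (i + j)"
    by simp
  finally show ?thesis .
qed

lemma skew_mult_add_left:
  assumes "\<sigma> 0 = 0"
  shows "skew_mult \<sigma> (f + f') g = skew_mult \<sigma> f g + skew_mult \<sigma> f' g"
proof -
  let ?M = "max (degree f) (degree f')"
  have "degree (f + f') \<le> ?M" by (rule degree_add_le_max)
  then show ?thesis
    by (simp add: skew_mult_bound[where \<sigma> = \<sigma> and M = ?M and N = "degree g", OF assms]
        sum.distrib[symmetric] add_monom[symmetric] distrib_right)
qed

lemma skew_mult_add_right:
  assumes "\<sigma> 0 = 0" and add: "\<And>a b. \<sigma> (a + b) = \<sigma> a + \<sigma> b"
  shows "skew_mult \<sigma> f (g + g') = skew_mult \<sigma> f g + skew_mult \<sigma> f g'"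
proof -
  let ?N = "max (degree g) (degree g')"
  have pow: "(\<sigma> ^^ i) (a + b) = (\<sigma> ^^ i) a + (\<sigma> ^^ i) b" for i a b
    by (induction i) (simp_all add: add)
  have "degree (g + g') \<le> ?N" by (rule degree_add_le_max)
  then show ?thesis
    by (simp add: skew_mult_bound[where \<sigma> = \<sigma> and M = "degree f" and N = ?N, OF assms(1)]
        sum.distrib[symmetric] add_monom[symmetric] distrib_left pow)
qed

lemma poly_monom_induct [case_names add monom]:
  assumes "\<And>p q. P p \<Longrightarrow> P q \<Longrightarrow> P (p + q)" "\<And>a n. P (monom a n)"
  shows "P p"
proof -
  have "P (\<Sum>i\<le>n. monom (coeff p i) i)" for n
    by (induction n) (simp_all add: assms)
  then show ?thesis
    by (metis poly_as_sum_of_monoms)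
qed

lemma skew_mult_assoc:
  assumes z: "\<sigma> 0 = 0" and add: "\<And>a b. \<sigma> (a + b) = \<sigma> a + \<sigma> b"
    and mult: "\<And>a b. \<sigma> (a * b) = \<sigma> a * \<sigma> b"
  shows "skew_mult \<sigma> (skew_mult \<sigma> f g) k = skew_mult \<sigma> f (skew_mult \<sigma> g k)"
proof -
  have pow: "(\<sigma> ^^ i) (a * b) = (\<sigma> ^^ i) a * (\<sigma> ^^ i) b" for i a b
    by (induction i) (simp_all add: mult)
  note lin = skew_mult_add_left[of \<sigma>, OF z] skew_mult_add_right[of \<sigma>, OF z add]
  show ?thesis
  proof (induction f rule: poly_monom_induct)
    case (monom a i)
    show ?case
    proof (induction g rule: poly_monom_induct)
      case (monom b j)
      show ?case
      proof (induction k rule: poly_monom_induct)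
        case (monom c l)
        show ?case by (simp add: skew_mult_monom z pow funpow_add algebra_simps)
      qed (simp add: lin)
    qed (simp add: lin)
  qed (simp add: lin)
qed

lemma q_shift_simps [simp]:
  "q_shift q 0 = 0" "q_shift q 1 = 1"
  "q_shift q (a + b) = q_shift q a + q_shift q b"
  "q_shift q (a * b) = q_shift q a * q_shift q b"
  "q_shift q [:c:] = [:c:]"
  by (simp_all add: q_shift_def pcompose_add pcompose_mult pcompose_1)

lemma q_shift_pow_simps [simp]:
  "(q_shift q ^^ i) 0 = 0" "(q_shift q ^^ i) 1 = 1" "(q_shift q ^^ i) [:c:] = [:c:]"
  by (induction i) simp_all

lemma q_shift_monom: "q_shift q (monom c k) = monom (c * q ^ k) k"
  by (induction k)
    (auto simp: q_shift_def monom_Suc pcompose_pCons monom_0 smult_monom algebra_simps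
      simp flip: mult_monom)

lemma q_shift_pow_monom: "(q_shift q ^^ j) (monom c k) = monom (c * q ^ (j * k)) k"
  by (induction j) (simp_all add: q_shift_monom power_add algebra_simps)


abbreviation (input) qp_mult :: "'k::field \<Rightarrow> 'k poly poly \<Rightarrow> 'k poly poly \<Rightarrow> 'k poly poly"
  where "qp_mult q \<equiv> skew_mult (q_shift q)"
abbreviation (input) qp_scale :: "'k::field \<Rightarrow> 'k poly poly \<Rightarrow> 'k poly poly"
  where "qp_scale c \<equiv> Polynomial.smult [:c:]"

lemma qp_mult_add:
  "qp_mult q (f + f') g = qp_mult q f g + qp_mult q f' g"
  "qp_mult q f (g + g') = qp_mult q f g + qp_mult q f g'"
  by (simp_all add: skew_mult_add_left skew_mult_add_right)

lemma qp_mult_assoc: "qp_mult q (qp_mult q f g) k = qp_mult q f (qp_mult q g k)"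
  by (rule skew_mult_assoc) simp_all

lemma qp_mult_monom: "qp_mult q (monom a i) (monom b j) = monom (a * (q_shift q ^^ i) b) (i + j)"
  by (simp add: skew_mult_monom)

lemma qp_mult_one [simp]: "qp_mult q 1 f = f" "qp_mult q f 1 = f"
proof -
  show "qp_mult q 1 f = f"
    by (induction f rule: poly_monom_induct)
      (simp_all add: qp_mult_add qp_mult_monom flip: monom_eq_1)
  show "qp_mult q f 1 = f"
    by (induction f rule: poly_monom_induct)
      (simp_all add: qp_mult_add qp_mult_monom q_shift_pow_monom flip: monom_eq_1)
qed

lemma qp_mult_scale:
  "qp_mult q (qp_scale c f) g = qp_scale c (qp_mult q f g)"
  "qp_mult q f (qp_scale c g) = qp_scale c (qp_mult q f g)"
proof -
  show "qp_mult q (qp_scale c f) g = qp_scale c (qp_mult q f g)"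
  proof (induction f rule: poly_monom_induct)
    case (monom a i)
    show ?case
      by (induction g rule: poly_monom_induct)
        (simp_all add: qp_mult_add smult_add_right qp_mult_monom smult_monom)
  qed (simp add: qp_mult_add smult_add_right)
  show "qp_mult q f (qp_scale c g) = qp_scale c (qp_mult q f g)"
  proof (induction f rule: poly_monom_induct)
    case (monom a i)
    have *: "(q_shift q ^^ i) (Polynomial.smult c b) = Polynomial.smult c ((q_shift q ^^ i) b)" for b
      by (induction i) (simp_all add: q_shift_def pcompose_smult)
    show ?case
      by (induction g rule: poly_monom_induct)
        (simp_all add: qp_mult_add smult_add_right qp_mult_monom smult_monom * mult_ac)
  qed (simp add: qp_mult_add smult_add_right)
qed

theorem quantum_plane_ring: "ring (quantum_plane q)"
  by (intro ringI abelian_groupI monoidI)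
    (auto simp: quantum_plane_def qp_mult_add qp_mult_assoc add_ac intro: exI[of _ "- _"] left_minus)

theorem quantum_plane_relation:
  fixes q :: "'k::field"
  shows "gen_x \<otimes>\<^bsub>quantum_plane q\<^esub> gen_h =
     q \<odot>\<^bsub>quantum_plane q\<^esub> (gen_h \<otimes>\<^bsub>quantum_plane q\<^esub> gen_x)"
proof -
  have h: "gen_h = (monom (monom (1::'k) 1) 0)" and x: "gen_x = (monom (monom (1::'k) 0) 1)"
    by (simp_all add: gen_h_def gen_x_def monom_0 monom_Suc)
  show ?thesis
    unfolding quantum_plane_def h x
    by (simp add: qp_mult_monom smult_monom q_shift_monom del: monom_0)
qed

lemma qp_power_commute:
  assumes "qp_mult q v u = qp_scale q (qp_mult q u v)"
  shows "qp_mult q ((qp_mult q v ^^ j) 1) ((qp_mult q u ^^ k) 1) =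
    qp_scale (q ^ (j * k)) (qp_mult q ((qp_mult q u ^^ k) 1) ((qp_mult q v ^^ j) 1))"
proof -
  let ?U = "\<lambda>k. (qp_mult q u ^^ k) 1" and ?V = "\<lambda>k. (qp_mult q v ^^ k) 1"
  have 1: "qp_mult q v (?U k) = qp_scale (q ^ k) (qp_mult q (?U k) v)" for k
  proof (induction k)
    case (Suc k)
    have "qp_mult q v (?U (Suc k)) = qp_mult q (qp_mult q v u) (?U k)"
      by (simp add: qp_mult_assoc)
    also have "\<dots> = qp_scale q (qp_mult q u (qp_mult q v (?U k)))"
      by (simp add: assms qp_mult_scale qp_mult_assoc)
    also have "\<dots> = qp_scale (q ^ Suc k) (qp_mult q (?U (Suc k)) v)"
      by (simp only: Suc) (simp add: qp_mult_scale qp_mult_assoc mult.commute)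
    finally show ?case .
  qed (simp add: pCons_one)
  show ?thesis
  proof (induction j)
    case (Suc j)
    have "qp_mult q (?V (Suc j)) (?U k) = qp_mult q v (qp_mult q (?V j) (?U k))"
      by (simp add: qp_mult_assoc)
    also have "\<dots> = qp_scale (q ^ (j * k)) (qp_mult q (qp_mult q v (?U k)) (?V j))"
      by (simp only: Suc) (simp add: qp_mult_scale qp_mult_assoc)
    also have "\<dots> = qp_scale (q ^ (Suc j * k)) (qp_mult q (?U k) (?V (Suc j)))"
      by (simp only: 1) (simp add: qp_mult_scale qp_mult_assoc power_add mult.commute)
    finally show ?case .
  qed (simp add: pCons_one)
qed

lemma qp_power_add: "qp_mult q ((qp_mult q u ^^ i) 1) ((qp_mult q u ^^ k) 1) = (qp_mult q u ^^ (i + k)) 1"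
  by (induction i) (simp_all add: qp_mult_assoc)

lemma mem_alg_End_iff:
  "f \<in> alg_End (quantum_plane q) \<longleftrightarrow>
     (\<forall>a b. f (a + b) = f a + f b) \<and> (\<forall>a b. f (qp_mult q a b) = qp_mult q (f a) (f b)) \<and>
     f 1 = 1 \<and> (\<forall>c a. f (qp_scale c a) = qp_scale c (f a))"
  by (auto simp: alg_End_def ring_hom_def quantum_plane_def)

lemma poly_poly_monom_induct [case_names add monom]:
  assumes "\<And>p q. P p \<Longrightarrow> P q \<Longrightarrow> P (p + q)" "\<And>c i j. P (monom (monom c i) j)"
  shows "P p"
proof (induction p rule: poly_monom_induct)
  case (monom a n)
  show ?case
    by (induction a rule: poly_monom_induct) (simp_all add: assms flip: add_monom)
qed (rule assms)

lemma qp_h_power: "(qp_mult q gen_h ^^ i) 1 = monom (monom 1 i) 0"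
proof (induction i)
  case (Suc i)
  have h: "gen_h = monom (monom 1 1) 0"
    by (simp add: gen_h_def monom_0 monom_Suc)
  have "(qp_mult q gen_h ^^ Suc i) 1 = qp_mult q gen_h (monom (monom 1 i) 0)"
    by (simp only: funpow.simps o_apply Suc)
  then show ?case
    by (simp only: h qp_mult_monom mult_monom) (simp add: mult_monom)
qed (simp add: monom_eq_1)

lemma qp_x_power: "(qp_mult q gen_x ^^ j) 1 = monom 1 j"
proof (induction j)
  case (Suc j)
  have x: "gen_x = monom 1 1"
    by (simp add: gen_x_def monom_0 monom_Suc)
  have "(qp_mult q gen_x ^^ Suc j) 1 = qp_mult q gen_x (monom 1 j)"
    by (simp only: funpow.simps o_apply Suc)
  then show ?case
    by (simp only: x qp_mult_monom) simp
qed (simp add: monom_eq_1)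

lemma qp_monom:
  "monom (monom c i) j =
     qp_scale c (qp_mult q ((qp_mult q gen_h ^^ i) 1) ((qp_mult q gen_x ^^ j) 1))"
  by (simp add: qp_h_power qp_x_power qp_mult_monom smult_monom del: monom_0)

text \<open>
  The generators determine an endomorphism, and every pair satisfying the defining relation
  occurs, so the definite description in \<^const>\<open>end_of_gens\<close> is proper in that case.
\<close>

theorem end_of_gens_ex1:
  fixes q :: "'k::field"
  assumes "qp_mult q v u = qp_scale q (qp_mult q u v)"
  shows "\<exists>!f. f \<in> alg_End (quantum_plane q) \<and> f gen_h = u \<and> f gen_x = v"
proof (rule ex_ex1I)
  let ?U = "\<lambda>k. (qp_mult q u ^^ k) 1" and ?V = "\<lambda>k. (qp_mult q v ^^ k) 1"
  define w where "w i j = qp_mult q (?U i) (?V j)" for i j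
  define G where "G j a = (\<Sum>i\<le>degree a. qp_scale (coeff a i) (w i j))" for j a
  define F where "F p = (\<Sum>j\<le>degree p. G j (coeff p j))" for p
  have G_bound: "G j a = (\<Sum>i\<le>N. qp_scale (coeff a i) (w i j))" if "degree a \<le> N" for j a N
    unfolding G_def using that by (intro sum.mono_neutral_left) (auto simp: coeff_eq_0)
  have G_add: "G j (a + b) = G j a + G j b" for j a b
  proof -
    have "qp_scale (c + d) p = qp_scale c p + qp_scale d p" for c d :: 'k and p
      by (simp flip: smult_add_left)
    then show ?thesis
      using degree_add_le_max[of a b]
      by (simp add: G_bound[where N = "max (degree a) (degree b)"] sum.distrib)
  qed
  have G_monom: "G j (monom c i) = qp_scale c (w i j)" for j c i
  proof -
    have "G j (monom c i) = (\<Sum>k\<le>i. if k = i then qp_scale c (w i j) else 0)"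
      unfolding G_bound[OF degree_monom_le] by (intro sum.cong) auto
    then show ?thesis by simp
  qed
  have [simp]: "G j 0 = 0" for j
    by (simp add: G_def)
  have F_bound: "F p = (\<Sum>j\<le>N. G j (coeff p j))" if "degree p \<le> N" for p N
    unfolding F_def using that by (intro sum.mono_neutral_left) (auto simp: coeff_eq_0)
  have F_add: "F (a + b) = F a + F b" for a b
    using degree_add_le_max[of a b]
    by (simp add: F_bound[where N = "max (degree a) (degree b)"] sum.distrib G_add)
  have F_monom: "F (monom (monom c i) j) = qp_scale c (w i j)" for c i j
  proof -
    have "F (monom (monom c i) j) = (\<Sum>k\<le>j. if k = j then G j (monom c i) else 0)"
      unfolding F_bound[OF degree_monom_le] by (intro sum.cong) auto
    then show ?thesis by (simp add: G_monom)
  qed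
  have F_scale: "F (qp_scale c a) = qp_scale c (F a)" for c a
    by (induction a rule: poly_poly_monom_induct)
      (simp_all add: smult_add_right F_add smult_monom F_monom mult.commute)
  have w_mult: "qp_mult q (w i j) (w k l) = qp_scale (q ^ (j * k)) (w (i + k) (j + l))" for i j k l
  proof -
    have "qp_mult q (w i j) (w k l) =
        qp_mult q (?U i) (qp_mult q (qp_mult q (?V j) (?U k)) (?V l))"
      by (simp add: w_def qp_mult_assoc)
    also have "\<dots> = qp_scale (q ^ (j * k))
        (qp_mult q (qp_mult q (?U i) (?U k)) (qp_mult q (?V j) (?V l)))"
      by (simp only: qp_power_commute[OF assms]) (simp add: qp_mult_scale qp_mult_assoc)
    finally show ?thesis
      by (simp add: qp_power_add w_def)
  qed
  have F_mult: "F (qp_mult q a b) = qp_mult q (F a) (F b)" for a b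
  proof (induction a rule: poly_poly_monom_induct)
    case (monom c i j)
    show ?case
    proof (induction b rule: poly_poly_monom_induct)
      case (monom d k l)
      show ?case
        by (simp add: qp_mult_monom q_shift_pow_monom mult_monom F_monom qp_mult_scale w_mult
            mult_ac)
    qed (simp add: qp_mult_add F_add)
  qed (simp add: qp_mult_add F_add)
  have "F 1 = 1" "F gen_h = u" "F gen_x = v"
  proof -
    have 1: "1 = monom (monom (1::'k) 0) 0" "gen_h = monom (monom (1::'k) 1) 0"
      "gen_x = monom (monom (1::'k) 0) 1"
      by (simp_all add: gen_h_def gen_x_def monom_0 monom_Suc pCons_one)
    show "F 1 = 1" "F gen_h = u" "F gen_x = v"
      unfolding 1 F_monom w_def by (simp_all add: monom_eq_1 pCons_one)
  qed
  with F_add F_mult F_scale show "\<exists>f. f \<in> alg_End (quantum_plane q) \<and> f gen_h = u \<and> f gen_x = v"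
    by (auto simp: mem_alg_End_iff)
next
  fix f g
  assume f: "f \<in> alg_End (quantum_plane q) \<and> f gen_h = u \<and> f gen_x = v"
    and g: "g \<in> alg_End (quantum_plane q) \<and> g gen_h = u \<and> g gen_x = v"
  have pow: "k ((qp_mult q a ^^ i) 1) = (qp_mult q (k a) ^^ i) 1"
    if "k \<in> alg_End (quantum_plane q)" for k a i
    using that by (induction i) (auto simp: mem_alg_End_iff)
  have "f p = g p" for p
  proof (induction p rule: poly_poly_monom_induct)
    case (monom c i j)
    have "k (monom (monom c i) j) = qp_scale c (qp_mult q ((qp_mult q u ^^ i) 1) ((qp_mult q v ^^ j) 1))"
      if k: "k \<in> alg_End (quantum_plane q)" "k gen_h = u" "k gen_x = v" for k
    proof -
      have "k (monom (monom c i) j) = qp_scale c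
          (qp_mult q (k ((qp_mult q gen_h ^^ i) 1)) (k ((qp_mult q gen_x ^^ j) 1)))"
        using k(1) unfolding qp_monom[where q = q] mem_alg_End_iff by metis
      then show ?thesis
        by (simp only: pow[OF k(1)] k(2,3))
    qed
    from this[of f] this[of g] f g show ?case by metis
  qed (use f g in \<open>simp add: mem_alg_End_iff\<close>)
  then show "f = g" by blast
qed

theorem alg_Aut_group: "group (alg_Aut (quantum_plane q))"
proof -
  let ?A = "quantum_plane q"
  let ?H = "alg_End ?A \<inter> Bij (carrier ?A)"
  have c: "carrier ?A = UNIV" by (simp add: quantum_plane_def)
  have "subgroup ?H (BijGroup (carrier ?A))"
  proof
    show "?H \<subseteq> carrier (BijGroup (carrier ?A))"
      by (auto simp: BijGroup_def)
  next
    fix f g assume "f \<in> ?H" "g \<in> ?H"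
    then show "f \<otimes>\<^bsub>BijGroup (carrier ?A)\<^esub> g \<in> ?H"
      using compose_Bij[of f "carrier ?A" g]
      by (auto simp: BijGroup_def mem_alg_End_iff c compose_def)
  next
    show "\<one>\<^bsub>BijGroup (carrier ?A)\<^esub> \<in> ?H"
      using id_Bij[of "carrier ?A"] by (auto simp: BijGroup_def mem_alg_End_iff c)
  next
    fix f assume f: "f \<in> ?H"
    then have b: "bij f" by (simp add: Bij_def c)
    have e: "inv\<^bsub>BijGroup (carrier ?A)\<^esub> f = inv_into UNIV f"
      using f by (subst inv_BijGroup) (auto simp: c)
    have i: "inv_into UNIV f y = x" if "f x = y" for x y
      using b that by (auto simp: bij_def)
    have r: "f (inv_into UNIV f y) = y" for y
      using b by (simp add: bij_def surj_f_inv_f)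
    have "inv_into UNIV f \<in> Bij (carrier ?A)"
      using b by (simp add: Bij_def c bij_imp_bij_inv)
    moreover have "inv_into UNIV f \<in> alg_End ?A"
      using f by (auto simp: mem_alg_End_iff r intro!: i)
    ultimately show "inv\<^bsub>BijGroup (carrier ?A)\<^esub> f \<in> ?H"
      unfolding e by blast
  qed
  then show ?thesis
    unfolding alg_Aut_def by (rule subgroup.subgroup_is_group[OF _ group_BijGroup])
qed

end

theory Submission
  imports Defs
begin

text \<open>
  Killing \<open>x\<close> or \<open>h\<close> makes the quantum plane \<open>A\<close> commutative, so every commutator lies in
  \<open>h A x\<close>.  For an automorphism \<open>f\<close>, the preimage of \<open>h x = (q - 1)\<^sup>-\<^sup>1 [x, h]\<close> is a multiple
  of a commutator, hence \<open>h x = f(h) s f(x)\<close> for some \<open>s\<close>.  Comparing degrees, first in \<open>x\<close> and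
  then in \<open>h\<close>, and using that \<open>f(h)\<close> and \<open>f(x)\<close> are not scalars, one of them is a multiple
  of \<open>h\<close> and the other one of \<open>x\<close>.
\<close>

section \<open>Multiplication in the quantum plane\<close>

text \<open>Both sides are additive in \<open>f\<close> and in \<open>g\<close>, so monomials
  suffice. In this convolution form the range of summation depends on \<open>k\<close> alone and not
  on degrees, so single coefficients can be read off.\<close>

lemma coeff_skew_mult:
  assumes z: "\<sigma> 0 = 0" and add: "\<And>a b. \<sigma> (a + b) = \<sigma> a + \<sigma> b"
  shows "coeff (skew_mult \<sigma> f g) k = (\<Sum>i\<le>k. coeff f i * (\<sigma> ^^ i) (coeff g (k - i)))"
proof -
  have pow0: "(\<sigma> ^^ i) 0 = 0" for i
    by (induction i) (simp_all add: z)
  have pow_add: "(\<sigma> ^^ i) (a + b) = (\<sigma> ^^ i) a + (\<sigma> ^^ i) b" for i a b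
    by (induction i) (simp_all add: add)
  note lin = skew_mult_add_left[of \<sigma>, OF z] skew_mult_add_right[of \<sigma>, OF z add]
  show ?thesis
  proof (induction f rule: poly_monom_induct)
    case (monom a i)
    show ?case
    proof (induction g rule: poly_monom_induct)
      case (monom b j)
      have "(\<Sum>l\<le>k. coeff (monom a i) l * (\<sigma> ^^ l) (coeff (monom b j) (k - l)))
          = (\<Sum>l\<le>k. if l = i then a * (\<sigma> ^^ i) (if j = k - i then b else 0) else 0)"
        by (intro sum.cong) auto
      then show ?case
        by (auto simp: skew_mult_monom z pow0)
    qed (simp add: lin pow_add distrib_left sum.distrib)
  qed (simp add: lin distrib_right sum.distrib)
qed

lemma coeff_qp_mult:
  "coeff (qp_mult q f g) k = (\<Sum>i\<le>k. coeff f i * (q_shift q ^^ i) (coeff g (k - i)))"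
  by (rule coeff_skew_mult) simp_all

text \<open>The substitution of \<open>q h\<close> for \<open>h\<close> fixes the point
  \<open>h = 0\<close>. Hence the twist disappears modulo \<open>h\<close>.\<close>

lemma coeff_0_q_shift_pow [simp]: "coeff ((q_shift q ^^ i) p) 0 = coeff p 0"
  by (induction i) (simp_all add: q_shift_def coeff_pcompose_0 poly_0_coeff_0)

lemma degree_q_shift_pow [simp]:
  assumes "q \<noteq> 0"
  shows "degree ((q_shift q ^^ i) p) = degree p"
  by (induction i) (simp_all add: q_shift_def degree_pcompose assms)

lemma q_shift_pow_eq_0_iff [simp]:
  assumes "q \<noteq> 0"
  shows "(q_shift q ^^ i) p = 0 \<longleftrightarrow> p = 0"
proof
  assume 0: "(q_shift q ^^ i) p = 0"
  then have "degree p = 0"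
    using degree_q_shift_pow[OF assms, of i p] by simp
  then show "p = 0"
    using 0 by (auto elim: degree_eq_zeroE)
qed simp

text \<open>The top coefficient is the product of \<open>lead_coeff f\<close> and a shift of
  \<open>lead_coeff g\<close>. It does not vanish, since K[h] is a domain and the shift is injective
  for \<open>q \<noteq> 0\<close>.\<close>

lemma qp_degree_mult:
  assumes "q \<noteq> 0" "f \<noteq> 0" "g \<noteq> 0"
  shows "degree (qp_mult q f g) = degree f + degree g"
proof (rule antisym)
  show "degree (qp_mult q f g) \<le> degree f + degree g"
  proof (rule degree_le, intro allI impI)
    fix k assume k: "degree f + degree g < k"
    have "coeff f i * (q_shift q ^^ i) (coeff g (k - i)) = 0" for i
      using k by (cases "degree f < i") (simp_all add: coeff_eq_0)
    then show "coeff (qp_mult q f g) k = 0"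
      unfolding coeff_qp_mult by (intro sum.neutral ballI)
  qed
  have "coeff (qp_mult q f g) (degree f + degree g)
      = (\<Sum>i\<le>degree f + degree g.
          if i = degree f then lead_coeff f * (q_shift q ^^ degree f) (lead_coeff g) else 0)"
    unfolding coeff_qp_mult
  proof (intro sum.cong refl)
    fix i
    show "coeff f i * (q_shift q ^^ i) (coeff g (degree f + degree g - i)) =
        (if i = degree f then lead_coeff f * (q_shift q ^^ degree f) (lead_coeff g) else 0)"
      by (cases i "degree f" rule: linorder_cases) (simp_all add: coeff_eq_0)
  qed
  also have "\<dots> \<noteq> 0"
    using assms by simp
  finally show "degree f + degree g \<le> degree (qp_mult q f g)"
    by (rule le_degree)
qed

lemma qp_mult_0 [simp]: "qp_mult q 0 f = 0" "qp_mult q f 0 = 0"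
  by (simp_all add: poly_eq_iff coeff_qp_mult)

lemma qp_mult_const_left: "qp_mult q [:a:] g = Polynomial.smult a g"
proof (rule poly_eqI)
  fix k
  have "coeff (qp_mult q [:a:] g) k = (\<Sum>i\<le>k. if i = 0 then a * coeff g k else 0)"
    unfolding coeff_qp_mult by (intro sum.cong) (auto simp: coeff_pCons split: nat.split)
  then show "coeff (qp_mult q [:a:] g) k = coeff (Polynomial.smult a g) k"
    by simp
qed

lemma qp_mult_gen_x: "qp_mult q f gen_x = pCons 0 f"
proof -
  have x: "gen_x = monom 1 1"
    by (simp add: gen_x_def monom_0 monom_Suc)
  show ?thesis
    by (induction f rule: poly_monom_induct)
      (simp_all add: qp_mult_add x qp_mult_monom flip: monom_Suc)
qed

lemma qp_gens_commute: "qp_mult q gen_x gen_h = qp_scale q (qp_mult q gen_h gen_x)"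
  using quantum_plane_relation[of q] by (simp add: quantum_plane_def)

lemma qp_commutator:
  "\<exists>w. qp_mult q a b - qp_mult q b a = qp_mult q gen_h (qp_mult q w gen_x)"
proof -
  let ?z = "qp_mult q a b - qp_mult q b a"
  \<comment> \<open>No shift occurs in the coefficient of \<open>x^0\<close>, and K[h] is
    commutative. So \<open>x\<close> can be split off on the right.\<close>
  have "coeff ?z 0 = 0"
    by (simp add: coeff_qp_mult)
  then obtain z where z: "?z = pCons 0 z"
    by (metis coeff_pCons_0 pCons_cases)
  \<comment> \<open>At \<open>h = 0\<close> the product is the ordinary convolution over K, which is
    symmetric by reversal of the index.\<close>
  have swap: "(\<Sum>i\<le>k. coeff (coeff a i) 0 * coeff (coeff b (k - i)) 0)
      = (\<Sum>i\<le>k. coeff (coeff b i) 0 * coeff (coeff a (k - i)) 0)" for k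
    by (rule sum.reindex_bij_witness[where i = "\<lambda>i. k - i" and j = "\<lambda>i. k - i"])
      (auto simp: mult.commute)
  have "coeff (coeff ?z k) 0 = 0" for k
    using swap[of k] by (simp add: coeff_qp_mult coeff_sum coeff_mult_0)
  then have "coeff (coeff z k) 0 = 0" for k
    unfolding z by (metis coeff_pCons_Suc)
  \<comment> \<open>Every coefficient vanishes at \<open>h = 0\<close>, so it is divisible by
    \<open>h\<close>. As coefficients stand on the left, the factor \<open>h\<close> comes out on
    the left of the whole polynomial.\<close>
  then have "[:0, 1:] dvd coeff z k" for k
    by (simp add: dvd_iff_poly_eq_0 poly_0_coeff_0)
  then have "[:[:0, 1:]:] dvd z"
    by (simp add: const_poly_dvd_iff)
  then obtain w where "z = [:[:0, 1:]:] * w" ..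
  then show ?thesis
    unfolding z by (intro exI[of _ w]) (simp add: qp_mult_gen_x qp_mult_const_left gen_h_def)
qed

lemma degree_1_eq_pCons:
  assumes "degree p = 1"
  shows "\<exists>a b. p = [:a, b:]"
proof -
  obtain a p' where p: "p = pCons a p'"
    by (rule pCons_cases)
  then have "degree p' = 0"
    using assms by (auto split: if_splits)
  then show ?thesis
    using p by (auto elim: degree_eq_zeroE)
qed

section \<open>Factorisations of the normal element\<close>

text \<open>Degrees in K[h] add up to 1, so a nonconstant \<open>a\<close> uses up the whole degree
  and leaves only nonzero constants for \<open>s\<close> and \<open>b\<close>. The constant term of
  \<open>a\<close> must then vanish as well.\<close>

lemma poly_mult_eq_gen:
  fixes a s b :: "'k::field poly"
  assumes "a * s * b = [:0, 1:]" "degree a \<noteq> 0"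
  shows "\<exists>c. a = [:0, c:] \<and> c \<noteq> 0" "\<exists>c. b = [:c:] \<and> c \<noteq> 0"
proof -
  have nz: "a \<noteq> 0" "s \<noteq> 0" "b \<noteq> 0"
    using assms by auto
  then have "degree a + degree s + degree b = 1"
    using arg_cong[OF assms(1), of degree] by (simp add: degree_mult_eq)
  then have deg: "degree a = 1" "degree s = 0" "degree b = 0"
    using assms(2) by auto
  then obtain c d where cd: "s = [:c:]" "b = [:d:]"
    by (auto elim!: degree_eq_zeroE)
  then show "\<exists>c. b = [:c:] \<and> c \<noteq> 0"
    using nz by auto
  obtain a0 a1 where a: "a = [:a0, a1:]"
    using degree_1_eq_pCons[OF deg(1)] by blast
  then show "\<exists>c. a = [:0, c:] \<and> c \<noteq> 0"
    using assms(1) deg(1) nz cd by (auto split: if_splits)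
qed

text \<open>By additivity of the \<open>x\<close>-degree exactly one of the three factors involves
  \<open>x\<close>, and the other two lie in K[h]. Comparing the coefficients of \<open>x^0\<close>
  and \<open>x^1\<close> leaves a factorisation of \<open>h\<close> in K[h], which decides where
  \<open>h\<close> goes.\<close>

lemma qp_factor_hx:
  fixes q :: "'k::field"
  assumes q: "q \<noteq> 0" and eq: "qp_mult q u (qp_mult q s v) = qp_mult q gen_h gen_x"
    and u: "\<And>c. u \<noteq> qp_scale c 1" and v: "\<And>c. v \<noteq> qp_scale c 1"
  shows "\<exists>l m. l \<noteq> 0 \<and> m \<noteq> 0 \<and>
    (u = qp_scale l gen_h \<and> v = qp_scale m gen_x \<or> u = qp_scale l gen_x \<and> v = qp_scale m gen_h)"
proof -
  have hx: "qp_mult q gen_h gen_x = [:0, [:0, 1:]:]"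
    by (simp add: qp_mult_gen_x gen_h_def)
  have nz: "u \<noteq> 0" "s \<noteq> 0" "v \<noteq> 0"
    using eq hx by auto
  then have nz': "qp_mult q s v \<noteq> 0"
    using eq hx by auto
  have deg: "degree u + degree s + degree v = 1"
    using arg_cong[OF eq, of degree] q nz nz' by (simp add: hx qp_degree_mult)
  \<comment> \<open>A factor that is free of \<open>x\<close> and not a scalar has positive degree
    in \<open>h\<close>.\<close>
  have nonconst: "degree a \<noteq> 0" if "w = [:a:]" "\<And>c. w \<noteq> qp_scale c 1" for a and w :: "'k poly poly"
  proof
    assume "degree a = 0"
    then obtain c where "a = [:c:]" by (rule degree_eq_zeroE)
    with that(1) that(2)[of c] show False by (simp add: one_pCons)
  qed
  have c0: "coeff u 0 * (coeff s 0 * coeff v 0) = 0"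
    using arg_cong[OF eq, of "\<lambda>p. coeff p 0"] by (simp add: hx coeff_qp_mult)
  have c1: "coeff u 0 * (coeff s 0 * coeff v 1 + coeff s 1 * q_shift q (coeff v 0))
      + coeff u 1 * q_shift q (coeff s 0 * coeff v 0) = [:0, 1:]"
    using arg_cong[OF eq, of "\<lambda>p. coeff p 1"] by (simp add: hx coeff_qp_mult)
  from deg consider "degree u = 0" "degree s = 0" "degree v = 1"
    | "degree u = 0" "degree s = 1" "degree v = 0" | "degree u = 1" "degree s = 0" "degree v = 0"
    by linarith
  then show ?thesis
  proof cases
    case 1
    then obtain a b v0 v1 where *: "u = [:a:]" "s = [:b:]" "v = [:v0, v1:]"
      by (metis degree_1_eq_pCons degree_eq_zeroE)
    then have "a * b * v1 = [:0, 1:]" "v0 = 0"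
      using c0 c1 nz by (auto simp: mult.assoc)
    with poly_mult_eq_gen[of a b v1] nonconst[OF *(1) u] * show ?thesis
      by (auto simp: gen_h_def gen_x_def)
  next
    \<comment> \<open>If the middle factor carried \<open>x\<close>, then \<open>u\<close> and
      \<open>v\<close> would both be nonconstant polynomials in \<open>h\<close>, too much for a
      product equal to \<open>h\<close>. This case is contradictory.\<close>
    case 2
    then obtain a b c where *: "u = [:a:]" "v = [:c:]" "coeff s 1 = b"
      by (metis degree_eq_zeroE)
    then have "a * b * q_shift q c = [:0, 1:]"
      using c1 by (simp add: mult.assoc)
    with poly_mult_eq_gen(2)[of a b "q_shift q c"] nonconst[OF *(1) u]
    have "degree (q_shift q c) = 0"
      by auto
    then show ?thesis
      using nonconst[OF *(2) v] degree_q_shift_pow[OF q, of 1 c] by simp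
  next
    case 3
    then obtain a b u0 u1 where *: "v = [:a:]" "s = [:b:]" "u = [:u0, u1:]"
      by (metis degree_1_eq_pCons degree_eq_zeroE)
    \<comment> \<open>Moving the \<open>x\<close> of \<open>u\<close> past \<open>s\<close> and
      \<open>v\<close> shifts both of them. The factors are reordered so that the nonconstant one
      comes first.\<close>
    then have eq': "q_shift q a * q_shift q b * u1 = [:0, 1:]" and "u0 = 0"
      using c0 c1 nz by (auto simp: mult_ac)
    moreover have "degree (q_shift q a) \<noteq> 0"
      using nonconst[OF *(1) v] degree_q_shift_pow[OF q, of 1 a] by simp
    ultimately obtain c d where cd: "q_shift q a = [:0, c:]" "c \<noteq> 0" "u1 = [:d:]" "d \<noteq> 0"
      using poly_mult_eq_gen[OF eq'] by auto
    \<comment> \<open>The shift is undone: it keeps the degree and the constant term and multiplies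
      the coefficient of \<open>h\<close> by \<open>q\<close>.\<close>
    have "degree a = 1"
      using cd degree_q_shift_pow[OF q, of 1 a] by simp
    then obtain a0 a1 where a: "a = [:a0, a1:]"
      using degree_1_eq_pCons by blast
    then have "a0 = 0" "a1 \<noteq> 0"
      using cd by (auto simp: q_shift_def pcompose_pCons)
    then show ?thesis
      using * cd \<open>u0 = 0\<close> a by (intro exI[of _ d] exI[of _ a1]) (simp add: gen_h_def gen_x_def)
  qed
qed

section \<open>Automorphisms\<close>

lemma alg_EndD:
  assumes "f \<in> alg_End (quantum_plane q)"
  shows "f (a + b) = f a + f b" "f (qp_mult q a b) = qp_mult q (f a) (f b)" "f 1 = 1"
    "f (qp_scale c a) = qp_scale c (f a)" "f (a - b) = f a - f b"
proof -
  show add: "f (a + b) = f a + f b" for a b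
    using assms by (auto simp: mem_alg_End_iff)
  show "f (qp_mult q a b) = qp_mult q (f a) (f b)" "f 1 = 1" "f (qp_scale c a) = qp_scale c (f a)"
    using assms by (auto simp: mem_alg_End_iff)
  show "f (a - b) = f a - f b"
    using add[of "a - b" b] by (simp add: algebra_simps)
qed

lemma alg_End_relation:
  assumes "f \<in> alg_End (quantum_plane q)"
  shows "qp_mult q (f gen_x) (f gen_h) = qp_scale q (qp_mult q (f gen_h) (f gen_x))"
  using arg_cong[OF qp_gens_commute, of f q] by (simp add: alg_EndD[OF assms])

text \<open>The images of the generators satisfy the defining relation, so the definite description
  is proper and picks out \<open>f\<close>. Equality of endomorphisms thereby reduces to the
  generators.\<close>

lemma end_of_gens_eq:
  assumes "f \<in> alg_End (quantum_plane q)"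
  shows "end_of_gens q (f gen_h) (f gen_x) = f"
  unfolding end_of_gens_def
  using end_of_gens_ex1[OF alg_End_relation[OF assms]] assms by (intro the1_equality) auto

lemma alg_End_eqI:
  assumes "f \<in> alg_End (quantum_plane q)" "g \<in> alg_End (quantum_plane q)"
    and "f gen_h = g gen_h" "f gen_x = g gen_x"
  shows "f = g"
  using assms by (metis end_of_gens_eq)

lemma end_of_gens:
  assumes "qp_mult q v u = qp_scale q (qp_mult q u v)"
  shows "end_of_gens q u v \<in> alg_End (quantum_plane q)"
    "end_of_gens q u v gen_h = u" "end_of_gens q u v gen_x = v"
  using theI'[OF end_of_gens_ex1[OF assms]] unfolding end_of_gens_def by auto

lemma alg_End_comp:
  assumes "f \<in> alg_End (quantum_plane q)" "g \<in> alg_End (quantum_plane q)"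
  shows "f \<circ> g \<in> alg_End (quantum_plane q)"
  using assms by (auto simp: mem_alg_End_iff)

lemma alg_End_id: "id \<in> alg_End (quantum_plane q)"
  by (simp add: mem_alg_End_iff)

lemma carrier_alg_Aut:
  "carrier (alg_Aut (quantum_plane q)) = {f \<in> alg_End (quantum_plane q). bij f}"
  by (auto simp: alg_Aut_def Bij_def quantum_plane_def)

text \<open>The carrier is the whole type, so the restricted composition of \<open>BijGroup\<close>
  is plain composition.\<close>

lemma mult_alg_Aut [simp]:
  assumes "f \<in> carrier (alg_Aut (quantum_plane q))" "g \<in> carrier (alg_Aut (quantum_plane q))"
  shows "f \<otimes>\<^bsub>alg_Aut (quantum_plane q)\<^esub> g = f \<circ> g"
  using assms
  by (auto simp: alg_Aut_def BijGroup_def quantum_plane_def compose_def fun_eq_iff)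

lemma one_alg_Aut [simp]: "\<one>\<^bsub>alg_Aut (quantum_plane q)\<^esub> = id"
  by (auto simp: alg_Aut_def BijGroup_def quantum_plane_def)

lemma alg_Aut_memI:
  assumes "f \<in> alg_End (quantum_plane q)" "g \<in> alg_End (quantum_plane q)" "f \<circ> g = id" "g \<circ> f = id"
  shows "f \<in> carrier (alg_Aut (quantum_plane q))"
  using assms by (auto simp: carrier_alg_Aut intro: o_bij)

section \<open>The diagonal maps and the maps swapping the generators\<close>

lemma t_map:
  shows "t_map q l m \<in> alg_End (quantum_plane q)"
    "t_map q l m gen_h = qp_scale l gen_h" "t_map q l m gen_x = qp_scale m gen_x"
proof -
  \<comment> \<open>Rescaling multiplies both sides of the defining relation by the same factor
    \<open>l * m\<close>.\<close>
  have "qp_mult q (qp_scale m gen_x) (qp_scale l gen_h)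
      = qp_scale q (qp_mult q (qp_scale l gen_h) (qp_scale m gen_x))"
    by (simp add: qp_mult_scale qp_gens_commute mult_ac)
  from end_of_gens[OF this] show "t_map q l m \<in> alg_End (quantum_plane q)"
    "t_map q l m gen_h = qp_scale l gen_h" "t_map q l m gen_x = qp_scale m gen_x"
    by (simp_all add: t_map_def quantum_plane_def)
qed

text \<open>Exchanging the generators turns \<open>x h = q h x\<close> into
  \<open>h x = q x h\<close>, and the right side equals \<open>q^2 h x\<close>. So the relation
  survives when \<open>q^2 = 1\<close>.\<close>

lemma t'_map:
  assumes "q * q = 1"
  shows "t'_map q l m \<in> alg_End (quantum_plane q)"
    "t'_map q l m gen_h = qp_scale l gen_x" "t'_map q l m gen_x = qp_scale m gen_h"
proof -
  have "qp_mult q (qp_scale m gen_h) (qp_scale l gen_x)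
      = qp_scale q (qp_mult q (qp_scale l gen_x) (qp_scale m gen_h))"
    by (simp add: qp_mult_scale qp_gens_commute) (simp add: assms mult_ac)
  from end_of_gens[OF this] show "t'_map q l m \<in> alg_End (quantum_plane q)"
    "t'_map q l m gen_h = qp_scale l gen_x" "t'_map q l m gen_x = qp_scale m gen_h"
    by (simp_all add: t'_map_def quantum_plane_def)
qed

lemma iota_eq_t'_map: "iota q = t'_map q 1 1"
  by (simp add: iota_def t'_map_def quantum_plane_def flip: one_pCons)

lemma t_map_comp: "t_map q l m \<circ> t_map q l' m' = t_map q (l * l') (m * m')"
  by (rule alg_End_eqI[where q = q])
    (simp_all add: alg_End_comp t_map alg_EndD[OF t_map(1)] mult_ac)

lemma t_map_one: "t_map q 1 1 = id"
  by (rule alg_End_eqI[where q = q]) (simp_all add: t_map alg_End_id flip: one_pCons)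

lemma t'_map_comp:
  assumes "q * q = 1"
  shows "t'_map q l m \<circ> t'_map q l' m' = t_map q (m * l') (l * m')"
  by (rule alg_End_eqI[where q = q])
    (simp_all add: alg_End_comp t_map t'_map assms alg_EndD[OF t'_map(1)[OF assms]] mult_ac)

text \<open>Together the two equations show that moving \<open>t_map q l m\<close> from the right of
  a swap to its left exchanges \<open>l\<close> and \<open>m\<close>, which is what normality of the
  torus needs.\<close>

lemma t_map_t'_map_comp:
  assumes "q * q = 1"
  shows "t_map q l m \<circ> t'_map q l' m' = t'_map q (m * l') (l * m')"
    "t'_map q l' m' \<circ> t_map q l m = t'_map q (l' * l) (m' * m)"
  by (rule alg_End_eqI[where q = q];
      simp add: alg_End_comp t_map t'_map assms alg_EndD[OF t_map(1)]
        alg_EndD[OF t'_map(1)[OF assms]] mult_ac)+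

lemma t_map_in_Aut:
  assumes "l \<noteq> 0" "m \<noteq> 0"
  shows "t_map q l m \<in> carrier (alg_Aut (quantum_plane q))"
  using assms
  by (intro alg_Aut_memI[where g = "t_map q (1 / l) (1 / m)"])
    (simp_all add: t_map t_map_comp t_map_one)

lemma t'_map_in_Aut:
  assumes "q * q = 1" "l \<noteq> 0" "m \<noteq> 0"
  shows "t'_map q l m \<in> carrier (alg_Aut (quantum_plane q))"
  using assms
  \<comment> \<open>The parameters cross over in a composition of two swaps, hence the reversed
    order in the inverse.\<close>
  by (intro alg_Aut_memI[where g = "t'_map q (1 / m) (1 / l)"])
    (simp_all add: t'_map t'_map_comp t_map_one)

section \<open>Determination of all automorphisms\<close>

lemma alg_Aut_gens:
  assumes q: "q \<noteq> 0" "q \<noteq> 1" and f: "f \<in> carrier (alg_Aut (quantum_plane q))"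
  shows "\<exists>l m. l \<noteq> 0 \<and> m \<noteq> 0 \<and>
    (f gen_h = qp_scale l gen_h \<and> f gen_x = qp_scale m gen_x \<or>
     f gen_h = qp_scale l gen_x \<and> f gen_x = qp_scale m gen_h)"
proof -
  have endo: "f \<in> alg_End (quantum_plane q)" and bij: "bij f"
    using f by (auto simp: carrier_alg_Aut)
  note hom = alg_EndD[OF endo]
  obtain h' x' where pre: "f h' = gen_h" "f x' = gen_x"
    using bij by (metis bij_pointE)
  obtain w where w: "qp_mult q x' h' - qp_mult q h' x' = qp_mult q gen_h (qp_mult q w gen_x)"
    using qp_commutator by blast
  \<comment> \<open>The image of the commutator of the preimages is computed twice: through its
    factorisation with \<open>w\<close>, and as \<open>x h - h x = (q - 1) h x\<close>. Since
    \<open>q \<noteq> 1\<close>, the scalar can be moved into the middle factor.\<close>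
  have "qp_mult q (f gen_h) (qp_mult q (f w) (f gen_x)) = f (qp_mult q x' h' - qp_mult q h' x')"
    by (simp only: w hom)
  also have "\<dots> = qp_scale q (qp_mult q gen_h gen_x) - qp_mult q gen_h gen_x"
    by (simp only: hom pre qp_gens_commute)
  also have "\<dots> = qp_scale (q - 1) (qp_mult q gen_h gen_x)"
    by (simp add: qp_mult_gen_x gen_h_def)
  finally have "qp_mult q (f gen_h) (qp_mult q (qp_scale (1 / (q - 1)) (f w)) (f gen_x))
      = qp_mult q gen_h gen_x"
    using q by (simp add: qp_mult_scale flip: one_pCons)
  \<comment> \<open>An injective algebra map fixes the scalars, so nothing else is sent to a
    scalar.\<close>
  moreover have "f g \<noteq> qp_scale c 1" if "\<And>c. g \<noteq> qp_scale c 1" for g c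
    using that bij hom(3) hom(4)[of c 1] by (metis bij_pointE)
  moreover have "gen_h \<noteq> qp_scale c 1" "gen_x \<noteq> qp_scale c 1" for c :: 'a
    by (simp_all add: gen_h_def gen_x_def one_pCons)
  ultimately show ?thesis
    by (intro qp_factor_hx[OF q(1)]) blast+
qed

text \<open>The swap case carries \<open>q * q = 1\<close>, so one rule serves every order of
  \<open>q\<close>: the case is contradictory unless the order is 2.\<close>

lemma alg_Aut_cases:
  assumes q: "q \<noteq> 0" "q \<noteq> 1" and f: "f \<in> carrier (alg_Aut (quantum_plane q))"
  obtains (torus) l m where "l \<noteq> 0" "m \<noteq> 0" "f = t_map q l m"
    | (swap) l m where "l \<noteq> 0" "m \<noteq> 0" "q * q = 1" "f = t'_map q l m"
proof -
  have endo: "f \<in> alg_End (quantum_plane q)"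
    using f by (auto simp: carrier_alg_Aut)
  obtain l m where lm: "l \<noteq> 0" "m \<noteq> 0"
    and "f gen_h = qp_scale l gen_h \<and> f gen_x = qp_scale m gen_x \<or>
     f gen_h = qp_scale l gen_x \<and> f gen_x = qp_scale m gen_h"
    using alg_Aut_gens[OF assms] by blast
  then consider (1) "f gen_h = qp_scale l gen_h" "f gen_x = qp_scale m gen_x"
    | (2) "f gen_h = qp_scale l gen_x" "f gen_x = qp_scale m gen_h"
    by blast
  then show thesis
  proof cases
    case 1
    then have "f = t_map q l m"
      by (intro alg_End_eqI[OF endo t_map(1)]) (simp_all add: t_map)
    with lm show thesis by (rule that(1))
  next
    case 2
    \<comment> \<open>For swapped images the preserved relation reads
      \<open>h x = q x h = q^2 h x\<close>, up to the nonzero factor \<open>l * m\<close>.\<close>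
    have "q * q = 1"
      using alg_End_relation[OF endo] lm
      by (simp add: 2 qp_mult_scale qp_gens_commute qp_mult_gen_x) (simp add: gen_h_def)
    moreover from this 2 have "f = t'_map q l m"
      by (intro alg_End_eqI[OF endo t'_map(1)]) (simp_all add: t'_map)
    ultimately show thesis
      using lm by (intro that(2))
  qed
qed

section \<open>The torus as a normal subgroup and the semidirect product\<close>

lemma torus_subgroup: "subgroup (torus q) (alg_Aut (quantum_plane q))"
proof (rule group.subgroupI[OF alg_Aut_group])
  show "torus q \<subseteq> carrier (alg_Aut (quantum_plane q))"
    by (auto simp: torus_def t_map_in_Aut)
  show "torus q \<noteq> {}"
    by (auto simp: torus_def intro!: exI[of _ 1])
  show "inv\<^bsub>alg_Aut (quantum_plane q)\<^esub> f \<in> torus q" if f: "f \<in> torus q" for f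
  proof -
    obtain l m where lm: "l \<noteq> 0" "m \<noteq> 0" "f = t_map q l m"
      using f by (auto simp: torus_def)
    then have "inv\<^bsub>alg_Aut (quantum_plane q)\<^esub> f = t_map q (1 / l) (1 / m)"
      by (intro group.inv_equality[OF alg_Aut_group])
        (simp_all add: t_map_in_Aut t_map_comp t_map_one)
    with lm show ?thesis
      unfolding torus_def by (intro CollectI exI[of _ "1 / l"] exI[of _ "1 / m"]) simp
  qed
  show "f \<otimes>\<^bsub>alg_Aut (quantum_plane q)\<^esub> g \<in> torus q" if "f \<in> torus q" "g \<in> torus q" for f g
    using that unfolding torus_def
    by (auto simp: t_map_in_Aut t_map_comp) (metis mult_eq_0_iff)
qed

text \<open>Torus elements commute with each other, and conjugation by a swap only exchanges the two
  parameters.\<close>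

lemma torus_normal:
  assumes "q \<noteq> 0" "q \<noteq> 1"
  shows "torus q \<lhd> alg_Aut (quantum_plane q)"
proof -
  let ?G = "alg_Aut (quantum_plane q)"
  interpret group ?G by (rule alg_Aut_group)
  have "f \<otimes>\<^bsub>?G\<^esub> g \<otimes>\<^bsub>?G\<^esub> inv\<^bsub>?G\<^esub> f \<in> torus q"
    if f: "f \<in> carrier ?G" and g: "g \<in> torus q" for f g
  proof -
    obtain l m where lm: "l \<noteq> 0" "m \<noteq> 0" "g = t_map q l m"
      using g by (auto simp: torus_def)
    then have gG: "g \<in> carrier ?G"
      by (simp add: t_map_in_Aut)
    \<comment> \<open>Conjugation is stated without the inverse, so that the composition formulas
      apply directly.\<close>
    have "\<exists>g'\<in>torus q. f \<circ> g = g' \<circ> f"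
      using assms f
    proof (cases rule: alg_Aut_cases)
      case (torus a b)
      then show ?thesis
        using lm g by (intro bexI[of _ g]) (simp_all add: t_map_comp mult.commute)
    next
      case (swap a b)
      then have "f \<circ> g = t_map q m l \<circ> f"
        using lm by (simp add: t_map_t'_map_comp mult.commute)
      then show ?thesis
        using lm by (auto simp: torus_def)
    qed
    then obtain g' where g': "g' \<in> torus q" "f \<circ> g = g' \<circ> f" ..
    then have g'G: "g' \<in> carrier ?G"
      using torus_subgroup subgroup.subset by blast
    have "f \<otimes>\<^bsub>?G\<^esub> g = g' \<otimes>\<^bsub>?G\<^esub> f"
      using f gG g'G g' by simp
    then have "f \<otimes>\<^bsub>?G\<^esub> g \<otimes>\<^bsub>?G\<^esub> inv\<^bsub>?G\<^esub> f = g'"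
      using f g'G by (simp add: m_assoc del: mult_alg_Aut one_alg_Aut)
    then show ?thesis
      using g' by simp
  qed
  then show ?thesis
    using torus_subgroup normal_inv_iff by blast
qed

text \<open>The map \<open>iota q\<close> is an involution outside the torus, and every swap is a
  torus element composed with it.\<close>

lemma Aut_semidirect:
  assumes q: "q \<noteq> 0" "q \<noteq> 1" "q * q = 1"
  shows "internal_semidirect (alg_Aut (quantum_plane q)) (torus q) (swap_group q)"
  unfolding internal_semidirect_def
proof (intro conjI)
  let ?G = "alg_Aut (quantum_plane q)"
  have iota: "iota q \<in> carrier ?G" "iota q \<circ> iota q = id"
    using q by (simp_all add: iota_eq_t'_map t'_map_in_Aut t'_map_comp t_map_one)
  have id: "id \<in> carrier ?G"
    using monoid.one_closed[OF group.is_monoid[OF alg_Aut_group], of q] by simp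
  show "torus q \<lhd> ?G"
    using q by (intro torus_normal)
  have swap: "swap_group q = {id, iota q}"
    by (simp add: swap_group_def)
  have inv: "inv\<^bsub>?G\<^esub> id = id" "inv\<^bsub>?G\<^esub> iota q = iota q"
    using iota id by (simp_all add: group.inv_equality[OF alg_Aut_group])
  have swap_subset: "swap_group q \<subseteq> carrier ?G"
    using iota id by (simp add: swap)
  then show "subgroup (swap_group q) ?G"
  proof (rule group.subgroupI[OF alg_Aut_group])
    show "inv\<^bsub>?G\<^esub> f \<in> swap_group q" if "f \<in> swap_group q" for f
      using that inv by (auto simp: swap)
    show "f \<otimes>\<^bsub>?G\<^esub> g \<in> swap_group q" if "f \<in> swap_group q" "g \<in> swap_group q" for f g
      using that iota id by (auto simp: swap)
  qed (simp add: swap)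
  \<comment> \<open>The two maps differ at \<open>h\<close>: one value is \<open>x\<close>, the
    other a multiple of \<open>h\<close>.\<close>
  have "iota q \<noteq> t_map q l m" for l m
  proof
    assume "iota q = t_map q l m"
    then have "iota q gen_h = t_map q l m gen_h" by simp
    then show False
      using q(3) by (simp add: iota_eq_t'_map t_map t'_map) (simp add: gen_h_def gen_x_def)
  qed
  moreover have "id \<in> torus q"
    using subgroup.one_closed[OF torus_subgroup, of q] by simp
  ultimately show "torus q \<inter> swap_group q = {\<one>\<^bsub>?G\<^esub>}"
    by (auto simp: swap_group_def torus_def)
  show "torus q <#>\<^bsub>?G\<^esub> swap_group q = carrier ?G"
  proof
    show "torus q <#>\<^bsub>?G\<^esub> swap_group q \<subseteq> carrier ?G"
      using subgroup.subset[OF torus_subgroup] swap_subset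
      by (rule group.setmult_subset_G[OF alg_Aut_group])
  next
    show "carrier ?G \<subseteq> torus q <#>\<^bsub>?G\<^esub> swap_group q"
    proof
      fix f assume f: "f \<in> carrier ?G"
      have "\<exists>t\<in>torus q. \<exists>s\<in>swap_group q. f = t \<circ> s"
        using q(1,2) f
      proof (cases rule: alg_Aut_cases)
        case (torus l m)
        then show ?thesis
          by (auto simp: torus_def swap_group_def)
      next
        case (swap l m)
        \<comment> \<open>The torus factor acts after the swap, so \<open>l\<close>, the scalar at
          \<open>h\<close>, has to scale \<open>x\<close>; hence the exchanged parameters.\<close>
        then have "f = t_map q m l \<circ> iota q"
          by (simp add: iota_eq_t'_map t_map_t'_map_comp)
        moreover have "t_map q m l \<in> torus q"
          using swap by (auto simp: torus_def)
        ultimately show ?thesis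
          by (auto simp: swap_group_def)
      qed
      then obtain t s where ts: "t \<in> torus q" "s \<in> swap_group q" "f = t \<circ> s"
        by blast
      moreover have "t \<in> carrier ?G" "s \<in> carrier ?G"
        using ts subgroup.subset[OF torus_subgroup] swap_subset by blast+
      ultimately have "f = t \<otimes>\<^bsub>?G\<^esub> s"
        by simp
      with ts(1,2) show "f \<in> torus q <#>\<^bsub>?G\<^esub> swap_group q"
        unfolding set_mult_def by blast
    qed
  qed
qed

theorem theorem6p1:
  fixes q :: "'k::field" and n :: nat
  assumes "n \<ge> 2" and "primitive_root_of_unity n q"
  shows "(n = 2 \<longrightarrow>
            internal_semidirect (alg_Aut (quantum_plane q)) (torus q) (swap_group q) \<and>
            carrier (alg_Aut (quantum_plane q)) =
              {t_map q l m | l m. l \<noteq> 0 \<and> m \<noteq> 0} \<union> {t'_map q l m | l m. l \<noteq> 0 \<and> m \<noteq> 0}) \<and>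
         (n \<noteq> 2 \<longrightarrow>
            carrier (alg_Aut (quantum_plane q)) = torus q \<and>
            torus q = {t_map q l m | l m. l \<noteq> 0 \<and> m \<noteq> 0})"
proof -
  have prim: "q ^ n = 1" "\<And>m. 0 < m \<Longrightarrow> m < n \<Longrightarrow> q ^ m \<noteq> 1"
    using assms(2) by (auto simp: primitive_root_of_unity_def)
  have q0: "q \<noteq> 0"
    using prim(1) assms(1) by (auto simp: power_0_left)
  have q1: "q \<noteq> 1"
    using prim(2)[of 1] assms(1) by simp
  \<comment> \<open>For \<open>n > 2\<close> primitivity rules out \<open>q^2 = 1\<close>; this is
    the only place where the two cases of the theorem separate.\<close>
  have q2: "q * q = 1 \<longleftrightarrow> n = 2"
    using prim(1) prim(2)[of 2] assms(1) by (cases "n = 2") (auto simp: power2_eq_square)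
  have torus: "torus q \<subseteq> carrier (alg_Aut (quantum_plane q))"
    by (rule subgroup.subset[OF torus_subgroup])
  show ?thesis
  proof (intro conjI impI)
    assume n: "n = 2"
    with q2 have qq: "q * q = 1" by simp
    show "internal_semidirect (alg_Aut (quantum_plane q)) (torus q) (swap_group q)"
      using q0 q1 qq by (rule Aut_semidirect)
    show "carrier (alg_Aut (quantum_plane q)) =
        {t_map q l m | l m. l \<noteq> 0 \<and> m \<noteq> 0} \<union> {t'_map q l m | l m. l \<noteq> 0 \<and> m \<noteq> 0}"
      using qq by (auto simp: t_map_in_Aut t'_map_in_Aut elim!: alg_Aut_cases[OF q0 q1])
  next
    assume "n \<noteq> 2"
    then show "carrier (alg_Aut (quantum_plane q)) = torus q"
      using torus q2 by (auto simp: torus_def elim!: alg_Aut_cases[OF q0 q1])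
  next
    show "torus q = {t_map q l m | l m. l \<noteq> 0 \<and> m \<noteq> 0}"
      by (rule torus_def)
  qed
qed

end
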